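(* Let $n\ge 2$ and let $A=(a_{ij})\in M_R$ be a reciprocal pairwise comparison matrix of order $n$. Then $0\le RIC(A)\le 1$.
   Context: $M_R$ is the set of all real $n\times n$ matrices $A=(a_{ij})$ with $a_{ij}>0$ for all $i,j$ and $a_{ij}=1/a_{ji}$ for all $i,j$ (reciprocal matrices). For $A\in M_R$ let $r_i=(a_{i1},\dots,a_{in})$ be its $i$-th row, let $\varphi_{ij}$ be the angle between $r_i$ and $r_j$, so $\cos\varphi_{ij}=\frac{r_i\cdot r_j}{|r_i|\,|r_j|}$ (Euclidean dot product and norm). The row inconsistency index is $RIC(A)=1-\frac{2\sum_{i=1}^{n-1}\sum_{j=i+1}^{n}\cos\varphi_{ij}}{n(n-1)}$. *)

theory Defs
  imports "HOL-Analysis.Analysis"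
begin

(* The order n of a matrix is CARD('n).  A linear order on the index type is required only to
   express the range i < j of the double sum in row_inconsistency_index. *)

definition reciprocal_matrices :: "(real ^ 'n ^ 'n) set" where
  "reciprocal_matrices = {A. (\<forall>i j. A $ i $ j > 0) \<and> (\<forall>i j. A $ i $ j = 1 / A $ j $ i)}"

(* The value for x = 0 or y = 0 is irrelevant: rows of reciprocal matrices are nonzero. *)
definition vec_angle :: "real ^ 'n \<Rightarrow> real ^ 'n \<Rightarrow> real" where
  "vec_angle x y = arccos ((x \<bullet> y) / (norm x * norm y))"

definition row_angle :: "real ^ 'n ^ 'n \<Rightarrow> 'n \<Rightarrow> 'n \<Rightarrow> real" where
  "row_angle A i j = vec_angle (row i A) (row j A)"

definition row_inconsistency_index :: "real ^ 'n::{finite,linorder} ^ 'n::{finite,linorder} \<Rightarrow> real" where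
  "row_inconsistency_index A =
     1 - 2 * (\<Sum>i\<in>UNIV. \<Sum>j\<in>{i<..}. cos (row_angle A i j))
         / (real CARD('n) * (real CARD('n) - 1))"

end

theory Submission
  imports Defs
begin

text \<open>The index is one minus the mean of the cosines over the n(n-1)/2 pairs of rows, so it
  suffices that each cosine lies in [0, 1]. The upper bound holds for any cosine. The lower bound
  (\<open>cos_row_angle_nonneg\<close>) holds because rows with positive entries have nonnegative
  dot product. \<open>sum_card_greaterThan\<close> counts the pairs, so that the normalising factor
  turns the sum into a mean.\<close>

lemma sum_card_greaterThan:
  "2 * (\<Sum>i\<in>(UNIV :: 'a::{finite,linorder} set). card {i<..}) = CARD('a) * (CARD('a) - 1)"
proof -
  \<comment> \<open>Both sides count the pairs i < j, grouped by the smaller or by the larger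
    index.\<close>
  have swap: "(\<Sum>i\<in>(UNIV :: 'a set). card {i<..}) = (\<Sum>i\<in>(UNIV :: 'a set). card {..<i})"
  proof -
    have "(\<Sum>i\<in>(UNIV :: 'a set). card {i<..}) = (\<Sum>i\<in>(UNIV :: 'a set). \<Sum>j\<in>UNIV. if i < j then 1 else 0)"
      by (simp add: sum.If_cases greaterThan_def)
    also have "\<dots> = (\<Sum>j\<in>(UNIV :: 'a set). \<Sum>i\<in>UNIV. if i < j then 1 else 0)"
      by (rule sum.swap)
    also have "\<dots> = (\<Sum>j\<in>(UNIV :: 'a set). card {..<j})"
      by (simp add: sum.If_cases lessThan_def)
    finally show ?thesis .
  qed
  \<comment> \<open>By linearity of the order, every index other than i lies on exactly one side of
    i.\<close>
  have split: "card {i<..} + card {..<i} = CARD('a) - 1" for i :: 'a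
  proof -
    have "card {i<..} + card {..<i} = card ({i<..} \<union> {..<i})"
      by (rule card_Un_disjoint[symmetric]) auto
    also have "{i<..} \<union> {..<i} = UNIV - {i}"
      by auto
    finally show ?thesis
      by (simp add: card_Diff_singleton)
  qed
  have "2 * (\<Sum>i\<in>(UNIV :: 'a set). card {i<..})
      = (\<Sum>i\<in>(UNIV :: 'a set). card {i<..} + card {..<i})"
    by (simp add: sum.distrib swap)
  then show ?thesis
    by (simp add: split)
qed

text \<open>Cauchy-Schwarz puts the quotient in [-1, 1], where \<open>cos\<close> inverts
  \<open>arccos\<close>. For a zero vector the quotient is 0 by the convention for division by zero,
  which is also in that range.\<close>

lemma cos_vec_angle: "cos (vec_angle x y) = (x \<bullet> y) / (norm x * norm y)"
proof -
  have "\<bar>(x \<bullet> y) / (norm x * norm y)\<bar> \<le> 1"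
    using Cauchy_Schwarz_ineq2[of x y] by (auto simp: abs_mult divide_le_eq_1)
  then show ?thesis
    unfolding vec_angle_def by (rule cos_arccos_abs)
qed

lemma cos_row_angle_nonneg:
  assumes "A \<in> reciprocal_matrices"
  shows "0 \<le> cos (row_angle A i j)"
proof -
  have "0 \<le> A $ k $ l" for k l
    using assms unfolding reciprocal_matrices_def by (blast intro: less_imp_le)
  then have "0 \<le> row i A \<bullet> row j A"
    by (simp add: inner_vec_def row_def sum_nonneg)
  then show ?thesis
    by (simp add: row_angle_def cos_vec_angle)
qed

theorem proposition3:
  fixes A :: "real ^ 'n::{finite,linorder} ^ 'n::{finite,linorder}"
  assumes "CARD('n) \<ge> 2"
    and "A \<in> reciprocal_matrices"
  shows "0 \<le> row_inconsistency_index A \<and> row_inconsistency_index A \<le> 1"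
proof -
  define S where "S = (\<Sum>i\<in>UNIV. \<Sum>j\<in>{i<..}. cos (row_angle A i j))"
  define N where "N = real CARD('n) * (real CARD('n) - 1)"
  \<comment> \<open>At least two indices are required here: for n = 1 the factor n - 1
    vanishes.\<close>
  have "N > 0"
    using assms(1) by (simp add: N_def)
  have "0 \<le> S"
    unfolding S_def by (intro sum_nonneg cos_row_angle_nonneg assms(2))
  have "S \<le> (\<Sum>i\<in>(UNIV :: 'n set). \<Sum>j\<in>{i<..}. 1)"
    unfolding S_def by (intro sum_mono cos_le_one)
  then have "2 * S \<le> real (2 * (\<Sum>i\<in>(UNIV :: 'n set). card {i<..}))"
    by simp
  also have "\<dots> = N"
    \<comment> \<open>The count uses truncated subtraction on naturals; it agrees with the real n -
      1 since n is at least 1.\<close>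
    unfolding sum_card_greaterThan using assms(1) by (simp add: N_def of_nat_diff)
  finally have "2 * S / N \<le> 1"
    using \<open>N > 0\<close> by simp
  moreover have "0 \<le> 2 * S / N"
    using \<open>N > 0\<close> \<open>0 \<le> S\<close> by simp
  ultimately show ?thesis
    by (simp add: row_inconsistency_index_def flip: S_def N_def)
qed

end
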